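(* Let $\mathcal{L}=(L,\wedge,\vee,\otimes,0,1)$ be an integral $\ell$-monoid, let $\alpha$ be a fuzzy regular expression over a finite alphabet $X$ (with scalars from $L$), and let $Y$ be an alphabet associated with $\alpha$. Then for every $u\in X^*$ the supremum below exists in $L$ and $$\|\alpha\|(u)=\bigvee_{v\in U_Y(u)}\varphi_\alpha^*(v)\otimes\|\alpha_R\|(v).$$
   Context: **Integral $\ell$-monoid.** An algebra $(L,\wedge,\vee,\otimes,0,1)$ such that $(L,\wedge,\vee,0,1)$ is a lattice with least element $0$ and greatest element $1$ (not necessarily complete), $(L,\otimes,1)$ is a (not necessarily commutative) monoid whose unit is the greatest element $1$, $x\otimes 0=0\otimes x=0$, $x\otimes(y\vee z)=(x\otimes y)\vee(x\otimes z)$ and $(x\vee y)\otimes z=(x\otimes z)\vee(y\otimes z)$ for all $x,y,z\in L$. **Fuzzy languages.** A fuzzy language over an alphabet $Z$ is a map $f:Z^*\to L$ ($\varepsilon$ is the empty word). For $\lambda\in L$: $(\lambda\otimes f)(u)=\lambda\otimes f(u)$; $(f\vee g)(u)=f(u)\vee g(u)$; $(fg)(u)=\bigvee_{u=vw}f(v)\otimes g(w)$; $f^0$ is the characteristic function of $\{\varepsilon\}$ (value $1$ at $\varepsilon$, $0$ elsewhere), $f^{n+1}=f^nf$, and $f^*=\bigvee_{n\ge 0}f^n$ pointwise (this supremum exists because $\mathcal L$ is integral). **Fuzzy regular expressions** over a finite alphabet $X$ are defined inductively: $\emptyset$, $\varepsilon$ and each $x\in X$ are fuzzy regular expressions; if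 $\alpha,\alpha_1,\alpha_2$ are, then so are $(\lambda\alpha)$ for $\lambda\in L$, $(\alpha_1+\alpha_2)$, $(\alpha_1\alpha_2)$ and $(\alpha^* )$. The fuzzy language $\|\alpha\|:X^*\to L$ is defined by: $\|\emptyset\|=0$ identically; for $\alpha\in X\cup\{\varepsilon\}$, $\|\alpha\|(u)=1$ if $u=\alpha$ and $0$ otherwise; $\|\lambda\alpha\|=\lambda\otimes\|\alpha\|$; $\|\alpha_1+\alpha_2\|=\|\alpha_1\|\vee\|\alpha_2\|$; $\|\alpha_1\alpha_2\|=\|\alpha_1\|\,\|\alpha_2\|$; $\|\alpha^*\|=\|\alpha\|^*$. A regular expression is a fuzzy regular expression without scalars; its fuzzy language takes values in $\{0,1\}$. **The regular expression $\alpha_R$.** Let $K\subseteq L$ be the (finite, possibly empty) set of scalars appearing in $\alpha$. An alphabet associated with $\alpha$ is a set $Y$ with $Y\cap X=\emptyset$ together with a bijection $K\to Y$, $\lambda\mapsto\lambda'$. Then $\alpha_R$ is the regular expression over $X\cup Y$ obtained from $\alpha$ by replacing each scalar $\lambda$ by the letter $\lambda'$ (so scalar multiplication by $\lambda$ becomes concatenation with $\lambda'$ on the left), and $\|\alpha_R\|:(X\cup Y)^*\to\{0,1\}\subseteq L$. The map $\varphi_\alpha^*:(X\cup Y)^*\to(L,\otimes,1)$ is the monoid homomorphism with $\varphi_\alpha^*(x)=1$ for $x\in X$ and $\varphi_\alpha^*(\lambda')=\lambda$ for $\lambda'\in Y$. **$U_Y(u)$.** For $u\in X^*$, $U_Y(u)\subseteq(X\cup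 Y)^*$ is the shuffle of $\{u\}$ with $Y^*$, i.e. the set of all words of the form $u_1v_1u_2v_2\cdots u_nv_n$ with $n\in\mathbb N$, $u_i\in X^*$, $u=u_1\cdots u_n$, $v_i\in Y^*$ (with $\emptyset^*=\{\varepsilon\}$); equivalently, all words over $X\cup Y$ that become $u$ after deletion of all letters from $Y$. *)

theory Defs
  imports Main "HOL-Library.Lub_Glb"
begin

text \<open>The meet and join are \<^const>\<open>inf\<close> and \<^const>\<open>sup\<close>; the product need not be commutative,
  the lattice need not be complete, and the degenerate case \<open>0 = 1\<close> is not excluded.\<close>

class integral_lmonoid = bounded_lattice + monoid_mult + mult_zero +
  assumes zero_eq_bot: "0 = bot"
    and one_eq_top: "1 = top"
    and mult_sup_distrib_left: "x * sup y z = sup (x * y) (x * z)"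
    and mult_sup_distrib_right: "sup x y * z = sup (x * z) (y * z)"

type_synonym ('a, 'l) flang = "'a list \<Rightarrow> 'l"

definition conc_lang :: "('a, 'l::integral_lmonoid) flang \<Rightarrow> ('a, 'l) flang \<Rightarrow> ('a, 'l) flang" where
  "conc_lang f g u = Sup_fin {f v * g w | v w. u = v @ w}"

primrec pow_lang :: "('a, 'l::integral_lmonoid) flang \<Rightarrow> nat \<Rightarrow> ('a, 'l) flang" where
  "pow_lang f 0 = (\<lambda>u. if u = [] then 1 else 0)"
| "pow_lang f (Suc n) = conc_lang (pow_lang f n) f"

text \<open>As the lattice is not complete, the supremum is given by a description operator; it is
  justified by \<open>isLub_star_lang\<close> below.\<close>

definition star_lang :: "('a, 'l::integral_lmonoid) flang \<Rightarrow> ('a, 'l) flang" where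
  "star_lang f u = (THE s. isLub UNIV (range (\<lambda>n. pow_lang f n u)) s)"

datatype (scalars: 'l, letters: 'a) fregex =
    Empty
  | Eps
  | Letter 'a
  | Scale 'l "('l, 'a) fregex"
  | Plus "('l, 'a) fregex" "('l, 'a) fregex"
  | Times "('l, 'a) fregex" "('l, 'a) fregex"
  | Star "('l, 'a) fregex"

primrec lang :: "('l::integral_lmonoid, 'a) fregex \<Rightarrow> ('a, 'l) flang" where
  "lang Empty = (\<lambda>u. 0)"
| "lang Eps = (\<lambda>u. if u = [] then 1 else 0)"
| "lang (Letter x) = (\<lambda>u. if u = [x] then 1 else 0)"
| "lang (Scale l r) = (\<lambda>u. l * lang r u)"
| "lang (Plus r s) = (\<lambda>u. sup (lang r u) (lang s u))"
| "lang (Times r s) = conc_lang (lang r) (lang s)"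
| "lang (Star r) = star_lang (lang r)"

text \<open>\<open>b\<close> is the bijection that sends a scalar \<open>\<lambda>\<close> of \<open>\<alpha>\<close> to its letter \<open>\<lambda>'\<close>.\<close>

definition associated_alphabet ::
    "'a set \<Rightarrow> ('l, 'a) fregex \<Rightarrow> 'a set \<Rightarrow> ('l \<Rightarrow> 'a) \<Rightarrow> bool" where
  "associated_alphabet X \<alpha> Y b \<longleftrightarrow> Y \<inter> X = {} \<and> bij_betw b (scalars \<alpha>) Y"

primrec regex_of :: "('l \<Rightarrow> 'a) \<Rightarrow> ('l, 'a) fregex \<Rightarrow> ('l, 'a) fregex" where
  "regex_of b Empty = Empty"
| "regex_of b Eps = Eps"
| "regex_of b (Letter x) = Letter x"
| "regex_of b (Scale l r) = Times (Letter (b l)) (regex_of b r)"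
| "regex_of b (Plus r s) = Plus (regex_of b r) (regex_of b s)"
| "regex_of b (Times r s) = Times (regex_of b r) (regex_of b s)"
| "regex_of b (Star r) = Star (regex_of b r)"

text \<open>Only the values on words over \<open>X \<union> Y\<close> matter, so the letters outside \<open>Y\<close> are those of \<open>X\<close>.\<close>

definition phi :: "('l::integral_lmonoid, 'a) fregex \<Rightarrow> 'a set \<Rightarrow> ('l \<Rightarrow> 'a) \<Rightarrow> 'a list \<Rightarrow> 'l" where
  "phi \<alpha> Y b v = prod_list (map (\<lambda>z. if z \<in> Y then inv_into (scalars \<alpha>) b z else 1) v)"

text \<open>The words \<open>u\<^sub>1 v\<^sub>1 \<dots> u\<^sub>n v\<^sub>n\<close> with \<open>u = u\<^sub>1 \<dots> u\<^sub>n\<close> and each \<open>v\<^sub>i\<close> a word over \<open>Y\<close>.\<close>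

definition U_set :: "'a set \<Rightarrow> 'a list \<Rightarrow> 'a list set" where
  "U_set Y u = {concat (map2 (@) us vs) | us vs.
     length us = length vs \<and> concat us = u \<and> set vs \<subseteq> lists Y}"

lemma U_set_eq_shuffles: "U_set Y u = (\<Union>w\<in>lists Y. shuffles u w)"
proof (intro equalityI subsetI)
  have *: "concat (map2 (@) us vs) \<in> (\<Union>w\<in>lists Y. shuffles (concat us) w)"
    if "length us = length vs" "set vs \<subseteq> lists Y" for us vs
    using that
  proof (induction us vs rule: list_induct2)
    case (Cons x us y vs)
    then obtain w where w: "w \<in> lists Y" "concat (map2 (@) us vs) \<in> shuffles (concat us) w"
      by auto
    have y: "c \<in> shuffles p w \<Longrightarrow> y @ c \<in> shuffles p (y @ w)" for c p
      by (induction y) (simp_all add: Cons_in_shuffles_rightI)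
    have x: "c \<in> shuffles p q \<Longrightarrow> x @ c \<in> shuffles (x @ p) q" for c p q
      by (induction x) (simp_all add: Cons_in_shuffles_leftI)
    have "concat (map2 (@) (x # us) (y # vs)) \<in> shuffles (concat (x # us)) (y @ w)"
      using x[OF y[OF w(2)]] by simp
    moreover have "y @ w \<in> lists Y" using w(1) Cons.prems by auto
    ultimately show ?case by blast
  qed auto
  show "z \<in> (\<Union>w\<in>lists Y. shuffles u w)" if "z \<in> U_set Y u" for z
  proof -
    from that obtain us vs where "z = concat (map2 (@) us vs)" "length us = length vs"
      "concat us = u" "set vs \<subseteq> lists Y" unfolding U_set_def by blast
    then show ?thesis using *[of us vs] by simp
  qed
  have "w \<in> lists Y \<Longrightarrow> z \<in> shuffles u w \<Longrightarrow> z \<in> U_set Y u" for w z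
  proof (induction u w arbitrary: z rule: shuffles.induct)
    case (1 ys)
    then show ?case unfolding U_set_def
      by (intro CollectI exI[of _ "[[]]"] exI[of _ "[ys]"]) simp
  next
    case (2 xs)
    then show ?case unfolding U_set_def
      by (intro CollectI exI[of _ "[xs]"] exI[of _ "[[]]"]) simp
  next
    case (3 x xs y ys)
    from 3(4) consider z' where "z = x # z'" "z' \<in> shuffles xs (y # ys)"
      | z' where "z = y # z'" "z' \<in> shuffles (x # xs) ys" by auto
    then show ?case
    proof cases
      case 1
      from 3(1)[OF 3(3) 1(2)] obtain us vs where "z' = concat (map2 (@) us vs)"
        "length us = length vs" "concat us = xs" "set vs \<subseteq> lists Y"
        unfolding U_set_def by blast
      then show ?thesis using 1 unfolding U_set_def
        by (intro CollectI exI[of _ "[x] # us"] exI[of _ "[] # vs"]) auto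
    next
      case 2
      have "ys \<in> lists Y" using 3(3) by simp
      from 3(2)[OF this 2(2)] obtain us vs where "z' = concat (map2 (@) us vs)"
        "length us = length vs" "concat us = x # xs" "set vs \<subseteq> lists Y"
        unfolding U_set_def by blast
      then show ?thesis using 2 3(3) unfolding U_set_def
        by (intro CollectI exI[of _ "[] # us"] exI[of _ "[y] # vs"]) auto
    qed
  qed
  then show "z \<in> U_set Y u" if "z \<in> (\<Union>w\<in>lists Y. shuffles u w)" for z
    using that by blast
qed

lemma mult_mono_lmonoid:
  fixes a b c d :: "'l::integral_lmonoid"
  assumes "a \<le> b" "c \<le> d"
  shows "a * c \<le> b * d"
proof -
  have "sup (a * c) (b * c) = b * c"
    using assms(1) by (simp add: sup.absorb2 flip: mult_sup_distrib_right)
  moreover have "sup (b * c) (b * d) = b * d"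
    using assms(2) by (simp add: sup.absorb2 flip: mult_sup_distrib_left)
  ultimately show ?thesis by (metis sup.cobounded1 order.trans)
qed

lemma finite_splits: "finite {f v * g w | v w. u = v @ w}"
proof -
  have "{f v * g w | v w. u = v @ w} \<subseteq> (\<lambda>n. f (take n u) * g (drop n u)) ` {..length u}"
  proof safe
    fix v w assume "u = v @ w"
    then show "f v * g w \<in> (\<lambda>n. f (take n (v @ w)) * g (drop n (v @ w))) ` {..length (v @ w)}"
      by (intro image_eqI[where x = "length v"]) simp_all
  qed
  then show ?thesis by (rule finite_subset) simp
qed

lemma conc_lang_upper: "f v * g w \<le> conc_lang f g (v @ w)"
  unfolding conc_lang_def by (rule Sup_fin.coboundedI[OF finite_splits]) auto

lemma conc_lang_least:
  assumes "\<And>v w. u = v @ w \<Longrightarrow> f v * g w \<le> t"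
  shows "conc_lang f g u \<le> t"
  unfolding conc_lang_def using assms by (intro Sup_fin.boundedI[OF finite_splits]) auto

lemma mult_Sup_fin_le:
  fixes t :: "'l::integral_lmonoid"
  assumes "finite A" "A \<noteq> {}" "\<And>a. a \<in> A \<Longrightarrow> a * c \<le> t"
  shows "Sup_fin A * c \<le> t"
  using assms
  by (induction rule: finite_ne_induct) (auto simp: mult_sup_distrib_right)

lemma pow_lang_le: "pow_lang f n u \<le> Sup_fin ((\<lambda>m. pow_lang f m u) ` {..length u})"
proof (induction n arbitrary: u)
  case 0
  show ?case by (intro Sup_fin.coboundedI imageI) simp_all
next
  case (Suc n)
  show ?case unfolding pow_lang.simps(2)
  proof (rule conc_lang_least)
    fix v w assume u: "u = v @ w"
    show "pow_lang f n v * f w \<le> Sup_fin ((\<lambda>m. pow_lang f m u) ` {..length u})"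
    proof (cases "w = []")
      case True
      have "pow_lang f n v * f w \<le> pow_lang f n u * 1"
        using True u by (intro mult_mono_lmonoid) (auto simp: one_eq_top)
      then show ?thesis using Suc[of u] by simp
    next
      case False
      have "pow_lang f n v * f w \<le> Sup_fin ((\<lambda>m. pow_lang f m v) ` {..length v}) * f w"
        by (rule mult_mono_lmonoid[OF Suc]) simp
      also have "\<dots> \<le> Sup_fin ((\<lambda>m. pow_lang f m u) ` {..length u})"
      proof (rule mult_Sup_fin_le)
        fix a assume "a \<in> (\<lambda>m. pow_lang f m v) ` {..length v}"
        then obtain m where m: "m \<le> length v" "a = pow_lang f m v" by auto
        have "a * f w \<le> pow_lang f (Suc m) u"
          using conc_lang_upper[of "pow_lang f m" v f w] m u by simp
        also have "\<dots> \<le> Sup_fin ((\<lambda>m. pow_lang f m u) ` {..length u})"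
          using m(1) u False by (intro Sup_fin.coboundedI imageI) (cases w; simp)+
        finally show "a * f w \<le> Sup_fin ((\<lambda>m. pow_lang f m u) ` {..length u})" .
      qed auto
      finally show ?thesis .
    qed
  qed
qed

lemma isLub_star_lang: "isLub UNIV (range (\<lambda>n. pow_lang f n u)) (star_lang f u)"
proof -
  let ?s = "Sup_fin ((\<lambda>m. pow_lang f m u) ` {..length u})"
  have "isLub UNIV (range (\<lambda>n. pow_lang f n u)) ?s"
  proof (rule isLubI2)
    show "isUb UNIV (range (\<lambda>n. pow_lang f n u)) ?s"
      by (auto intro!: isUbI setleI pow_lang_le)
    show "?s <=* Collect (isUb UNIV (range (\<lambda>n. pow_lang f n u)))"
    proof (rule setgeI, safe)
      fix t assume "isUb UNIV (range (\<lambda>n. pow_lang f n u)) t"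
      then show "?s \<le> t" by (intro Sup_fin.boundedI) (auto simp: isUb_def setle_def)
    qed
  qed
  moreover have "s = ?s" if "isLub UNIV (range (\<lambda>n. pow_lang f n u)) s" for s
  proof (rule antisym)
    show "s \<le> ?s" "?s \<le> s"
      using that calculation by (simp_all add: isLub_def leastP_def setge_def)
  qed
  ultimately show ?thesis unfolding star_lang_def by (rule theI)
qed

end

theory Submission
  imports Defs
begin

text \<open>In a lattice that is neither complete nor residuated, infinite suprema need not be preserved
  by multiplication. The supremum of the theorem is, because it is attained on finitely many
  words; so the induction on \<open>\<alpha>\<close> carries the stronger claim that \<open>p \<otimes> \<parallel>\<alpha>\<parallel>(u) \<otimes> q\<close> is below every
  upper bound of the elements \<open>p \<otimes> \<phi>(v) \<otimes> \<parallel>\<alpha>\<^sub>R\<parallel>(v) \<otimes> q\<close>, for all \<open>p\<close> and \<open>q\<close>. This claim is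
  stable under the regular operations. On the other side, \<open>f \<mapsto> \<phi> \<otimes> f\<close> commutes with the regular
  operations on languages whose values are central, such as \<open>\<parallel>\<alpha>\<^sub>R\<parallel>\<close>.\<close>

section \<open>Finite suprema and the star in an integral l-monoid\<close>

lemma zero_le_lmonoid [simp]: "0 \<le> (x::'l::integral_lmonoid)"
  by (simp add: zero_eq_bot)

lemma mult_Sup_fin_distrib_left:
  fixes x :: "'l::integral_lmonoid"
  assumes "finite A" "A \<noteq> {}"
  shows "x * Sup_fin A = Sup_fin ((\<lambda>a. x * a) ` A)"
  using Sup_fin.hom_commute[of "\<lambda>a. x * a" A] assms by (simp add: mult_sup_distrib_left)

lemma mult_Sup_fin_distrib_right:
  fixes x :: "'l::integral_lmonoid"
  assumes "finite A" "A \<noteq> {}"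
  shows "Sup_fin A * x = Sup_fin ((\<lambda>a. a * x) ` A)"
  using Sup_fin.hom_commute[of "\<lambda>a. a * x" A] assms by (simp add: mult_sup_distrib_right)

lemma mult_Sup_fin_mult_le:
  fixes t :: "'l::integral_lmonoid"
  assumes "finite A" "A \<noteq> {}" "\<And>a. a \<in> A \<Longrightarrow> p * a * q \<le> t"
  shows "p * Sup_fin A * q \<le> t"
  using assms
  by (induction rule: finite_ne_induct) (auto simp: mult_sup_distrib_left mult_sup_distrib_right)

lemma splits_nonempty: "{f v * g w | v w. u = v @ w} \<noteq> {}"
  by auto

lemma pow_lang_le_star_lang: "pow_lang f n u \<le> star_lang f u"
  using isLubD2[OF isLub_star_lang] by blast

text \<open>Powers with exponent up to \<open>length u\<close> already dominate every power at
  \<open>u\<close>. So at each word the star is a finite supremum, and multiplication distributes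
  over it.\<close>

lemma star_lang_eq_Sup_fin: "star_lang f u = Sup_fin ((\<lambda>n. pow_lang f n u) ` {..length u})"
proof (rule antisym)
  have "isUb UNIV (range (\<lambda>n. pow_lang f n u)) (Sup_fin ((\<lambda>n. pow_lang f n u) ` {..length u}))"
    by (auto intro!: isUbI setleI pow_lang_le)
  then show "star_lang f u \<le> Sup_fin ((\<lambda>n. pow_lang f n u) ` {..length u})"
    using isLub_star_lang isLub_le_isUb by blast
  show "Sup_fin ((\<lambda>n. pow_lang f n u) ` {..length u}) \<le> star_lang f u"
    by (intro Sup_fin.boundedI) (auto intro: pow_lang_le_star_lang)
qed

text \<open>Turns a scalar into a left factor of a concatenation, the form that
  \<open>regex_of\<close> gives it.\<close>

lemma conc_lang_point_Nil: "conc_lang (\<lambda>v. if v = [] then c else 0) f = (\<lambda>u. c * f u)"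
proof (intro ext antisym)
  fix u
  show "conc_lang (\<lambda>v. if v = [] then c else 0) f u \<le> c * f u"
    by (rule conc_lang_least) auto
  show "c * f u \<le> conc_lang (\<lambda>v. if v = [] then c else 0) f u"
    using conc_lang_upper[of "\<lambda>v. if v = [] then c else 0" "[]" f u] by simp
qed

section \<open>Languages with central values\<close>

definition central_lang :: "('a, 'l::integral_lmonoid) flang \<Rightarrow> bool" where
  "central_lang f \<longleftrightarrow> (\<forall>v x. x * f v = f v * x)"

lemma central_Sup_fin:
  fixes x :: "'l::integral_lmonoid"
  assumes "finite A" "A \<noteq> {}" "\<And>a. a \<in> A \<Longrightarrow> x * a = a * x"
  shows "x * Sup_fin A = Sup_fin A * x"
  using assms by (simp add: mult_Sup_fin_distrib_left mult_Sup_fin_distrib_right)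

lemma central_conc_lang:
  assumes "central_lang f" "central_lang g"
  shows "central_lang (conc_lang f g)"
  unfolding central_lang_def conc_lang_def
proof (intro allI central_Sup_fin[OF finite_splits splits_nonempty])
  fix u x a assume "a \<in> {f v * g w | v w. u = v @ w}"
  then obtain v w where a: "a = f v * g w" by blast
  have "x * f v * g w = f v * (x * g w)"
    using assms(1) by (metis central_lang_def mult.assoc)
  also have "x * g w = g w * x"
    using assms(2) by (metis central_lang_def)
  finally show "x * a = a * x" by (simp only: a mult.assoc)
qed

lemma central_pow_lang: "central_lang f \<Longrightarrow> central_lang (pow_lang f n)"
proof (induction n)
  case (Suc n)
  then show ?case by (simp add: central_conc_lang)
qed (simp add: central_lang_def)

lemma central_star_lang:
  assumes "central_lang f"
  shows "central_lang (star_lang f)"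
  unfolding central_lang_def star_lang_eq_Sup_fin
proof (intro allI central_Sup_fin)
  fix u x a assume "a \<in> (\<lambda>n. pow_lang f n u) ` {..length u}"
  then obtain n where "a = pow_lang f n u" by blast
  then show "x * a = a * x"
    using central_pow_lang[OF assms, of n] by (metis central_lang_def)
qed simp_all

text \<open>No scalar is left in \<open>regex_of b r\<close>, so its values arise from 0 and 1 by
  finite joins and products. Both commute with everything, and centrality survives these
  operations.\<close>

lemma central_lang_regex_of: "central_lang (lang (regex_of b r))"
proof (induction r)
  case (Scale l r)
  have "central_lang (\<lambda>u. if u = [b l] then 1 else 0 :: 'b)"
    by (simp add: central_lang_def)
  then show ?case using Scale by (simp add: central_conc_lang)
next
  case (Plus r s)
  have "x * sup (lang (regex_of b r) v) (lang (regex_of b s) v)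
      = sup (lang (regex_of b r) v) (lang (regex_of b s) v) * x" for x v
    unfolding mult_sup_distrib_left mult_sup_distrib_right
    using Plus.IH by (metis central_lang_def)
  then show ?case by (auto simp: central_lang_def)
qed (simp_all add: central_conc_lang central_star_lang, simp_all add: central_lang_def)

section \<open>Weighting a language by a monoid homomorphism\<close>

text \<open>The left factor is the homomorphic extension of \<open>h\<close> to words. Unlike
  \<open>phi\<close>, it does not refer to the scalar set of one expression, so \<open>h\<close> can
  stay fixed while the induction passes to subexpressions.\<close>

definition weigh :: "('a \<Rightarrow> 'l::integral_lmonoid) \<Rightarrow> ('a, 'l) flang \<Rightarrow> ('a, 'l) flang" where
  "weigh h f v = prod_list (map h v) * f v"

lemma weigh_point:
  "weigh h (\<lambda>v. if v = w then 1 else 0) = (\<lambda>v. if v = w then prod_list (map h w) else 0)"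
  by (auto simp: weigh_def)

text \<open>The weight of \<open>v @ w\<close> splits as weight of \<open>v\<close> times weight of
  \<open>w\<close>, and the second factor has to move past \<open>f v\<close> to reach
  \<open>g w\<close>. Centrality of \<open>f\<close> permits this without commutativity of the
  monoid.\<close>

lemma weigh_conc_lang:
  assumes "central_lang f"
  shows "weigh h (conc_lang f g) = conc_lang (weigh h f) (weigh h g)"
proof
  fix u
  have eq: "prod_list (map h (v @ w)) * (f v * g w) = weigh h f v * weigh h g w" for v w
  proof -
    have "prod_list (map h w) * f v = f v * prod_list (map h w)"
      using assms by (metis central_lang_def)
    then have "prod_list (map h w) * (f v * g w) = f v * (prod_list (map h w) * g w)"
      by (metis mult.assoc)
    then show ?thesis by (simp add: weigh_def mult.assoc)
  qed
  have "(\<lambda>a. prod_list (map h u) * a) ` {f v * g w | v w. u = v @ w}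
      = {prod_list (map h (v @ w)) * (f v * g w) | v w. u = v @ w}"
    by blast
  then show "weigh h (conc_lang f g) u = conc_lang (weigh h f) (weigh h g) u"
    unfolding eq
    by (simp add: weigh_def[of h "conc_lang f g"] conc_lang_def
        mult_Sup_fin_distrib_left[OF finite_splits splits_nonempty])
qed

lemma weigh_pow_lang:
  assumes "central_lang f"
  shows "weigh h (pow_lang f n) = pow_lang (weigh h f) n"
proof (induction n)
  case 0
  show ?case by (simp add: weigh_point cong: if_cong)
next
  case (Suc n)
  then show ?case by (simp add: weigh_conc_lang central_pow_lang[OF assms])
qed

text \<open>Both stars at \<open>u\<close> are finite suprema over the same exponents, so the weight
  moves inside and acts on each power.\<close>

lemma weigh_star_lang:
  assumes "central_lang f"
  shows "weigh h (star_lang f) = star_lang (weigh h f)"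
proof
  fix u
  have "weigh h (star_lang f) u = Sup_fin ((\<lambda>n. weigh h (pow_lang f n) u) ` {..length u})"
    unfolding weigh_def star_lang_eq_Sup_fin
    by (subst mult_Sup_fin_distrib_left) (auto simp: image_image)
  then show "weigh h (star_lang f) u = star_lang (weigh h f) u"
    by (simp add: weigh_pow_lang[OF assms] star_lang_eq_Sup_fin)
qed

section \<open>Suprema over the fibres of the deletion of letters\<close>

text \<open>With \<open>p = q = 1\<close> this says that \<open>f u\<close> is the supremum of
  \<open>F\<close> over the words that become \<open>u\<close> when the letters of \<open>Y\<close>
  are deleted. The factors \<open>p\<close> and \<open>q\<close> are the contexts in which a
  concatenation places a value. If \<open>u\<close> contains a letter of \<open>Y\<close>, the fibre
  is empty and \<open>f u = 0\<close> is forced.\<close>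

definition projects_to ::
    "'a set \<Rightarrow> ('a, 'l::integral_lmonoid) flang \<Rightarrow> ('a, 'l) flang \<Rightarrow> bool" where
  "projects_to Y F f \<longleftrightarrow>
     (\<forall>v. F v \<le> f (filter (\<lambda>z. z \<notin> Y) v)) \<and>
     (\<forall>u p q t. (\<forall>v. filter (\<lambda>z. z \<notin> Y) v = u \<longrightarrow> p * F v * q \<le> t) \<longrightarrow> p * f u * q \<le> t)"

lemma projects_toI:
  assumes "\<And>v. F v \<le> f (filter (\<lambda>z. z \<notin> Y) v)"
    and "\<And>u p q t. (\<And>v. filter (\<lambda>z. z \<notin> Y) v = u \<Longrightarrow> p * F v * q \<le> t) \<Longrightarrow> p * f u * q \<le> t"
  shows "projects_to Y F f"
  using assms unfolding projects_to_def by blast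

lemma projects_to_upper: "projects_to Y F f \<Longrightarrow> F v \<le> f (filter (\<lambda>z. z \<notin> Y) v)"
  unfolding projects_to_def by blast

lemma projects_to_least:
  assumes "projects_to Y F f" "\<And>v. filter (\<lambda>z. z \<notin> Y) v = u \<Longrightarrow> p * F v * q \<le> t"
  shows "p * f u * q \<le> t"
  using assms unfolding projects_to_def by blast

lemma projects_to_zero: "projects_to Y (\<lambda>v. 0) (\<lambda>u. 0)"
  by (rule projects_toI) simp_all

text \<open>Gives the base cases and the scalars at once: deletion fixes \<open>[x]\<close> for
  \<open>x\<close> outside \<open>Y\<close> and sends \<open>[b l]\<close> to the empty
  word.\<close>

lemma projects_to_point:
  "projects_to Y (\<lambda>v. if v = w then c else 0)
     (\<lambda>u. if u = filter (\<lambda>z. z \<notin> Y) w then c else 0)"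
proof (rule projects_toI)
  fix u p q t
  assume *: "\<And>v. filter (\<lambda>z. z \<notin> Y) v = u \<Longrightarrow> p * (if v = w then c else 0) * q \<le> t"
  show "p * (if u = filter (\<lambda>z. z \<notin> Y) w then c else 0) * q \<le> t"
    using *[of w] by auto
qed simp

lemma projects_to_sup:
  assumes "projects_to Y F f" "projects_to Y G g"
  shows "projects_to Y (\<lambda>v. sup (F v) (G v)) (\<lambda>u. sup (f u) (g u))"
proof (rule projects_toI)
  show "sup (F v) (G v) \<le> sup (f (filter (\<lambda>z. z \<notin> Y) v)) (g (filter (\<lambda>z. z \<notin> Y) v))" for v
    using assms by (intro sup_mono projects_to_upper)
  fix u p q t
  assume "\<And>v. filter (\<lambda>z. z \<notin> Y) v = u \<Longrightarrow> p * sup (F v) (G v) * q \<le> t"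
  then have "p * f u * q \<le> t" "p * g u * q \<le> t"
    by (auto intro!: projects_to_least[OF assms(1)] projects_to_least[OF assms(2)]
        simp: mult_sup_distrib_left mult_sup_distrib_right)
  then show "p * sup (f u) (g u) * q \<le> t"
    by (simp add: mult_sup_distrib_left mult_sup_distrib_right)
qed

text \<open>Deletion is a monoid homomorphism, so a split of \<open>v\<close> yields a split of its
  image, and preimages of two factors concatenate to a preimage of their product. The least bound is
  obtained by replacing one factor at a time.\<close>

lemma projects_to_conc_lang:
  assumes "projects_to Y F f" "projects_to Y G g"
  shows "projects_to Y (conc_lang F G) (conc_lang f g)"
proof (rule projects_toI)
  let ?d = "filter (\<lambda>z. z \<notin> Y)"
  fix v
  show "conc_lang F G v \<le> conc_lang f g (?d v)"
  proof (rule conc_lang_least)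
    fix v1 v2 assume v: "v = v1 @ v2"
    have "F v1 * G v2 \<le> f (?d v1) * g (?d v2)"
      using assms by (intro mult_mono_lmonoid projects_to_upper)
    also have "\<dots> \<le> conc_lang f g (?d v)"
      using v conc_lang_upper[of f "?d v1" g "?d v2"] by simp
    finally show "F v1 * G v2 \<le> conc_lang f g (?d v)" .
  qed
next
  let ?d = "filter (\<lambda>z. z \<notin> Y)"
  fix u p q t
  assume *: "\<And>v. ?d v = u \<Longrightarrow> p * conc_lang F G v * q \<le> t"
  show "p * conc_lang f g u * q \<le> t"
    unfolding conc_lang_def
  proof (rule mult_Sup_fin_mult_le[OF finite_splits splits_nonempty], safe)
    fix u1 u2 assume u: "u = u1 @ u2"
    \<comment> \<open>First \<open>g u2\<close> counts as part of the right context of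
      \<open>f u1\<close>; afterwards \<open>F v1\<close> joins the left context of
      \<open>g u2\<close>.\<close>
    have "p * f u1 * (g u2 * q) \<le> t"
    proof (rule projects_to_least[OF assms(1)])
      fix v1 assume v1: "?d v1 = u1"
      have "(p * F v1) * g u2 * q \<le> t"
      proof (rule projects_to_least[OF assms(2)])
        fix v2 assume v2: "?d v2 = u2"
        have "p * (F v1 * G v2) * q \<le> p * conc_lang F G (v1 @ v2) * q"
          by (intro mult_mono_lmonoid conc_lang_upper order.refl)
        also have "\<dots> \<le> t" using v1 v2 u by (intro *) simp
        finally show "(p * F v1) * G v2 * q \<le> t" by (simp add: mult.assoc)
      qed
      then show "p * F v1 * (g u2 * q) \<le> t" by (simp add: mult.assoc)
    qed
    then show "p * (f u1 * g u2) * q \<le> t" by (simp add: mult.assoc)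
  qed
qed

lemma projects_to_pow_lang:
  assumes "projects_to Y F f"
  shows "projects_to Y (pow_lang F n) (pow_lang f n)"
proof (induction n)
  case 0
  show ?case using projects_to_point[of Y "[]" 1] by simp
next
  case (Suc n)
  then show ?case using assms by (simp add: projects_to_conc_lang)
qed

lemma projects_to_star_lang:
  assumes "projects_to Y F f"
  shows "projects_to Y (star_lang F) (star_lang f)"
proof (rule projects_toI)
  let ?d = "filter (\<lambda>z. z \<notin> Y)"
  fix v
  \<comment> \<open>The star of \<open>F\<close> at \<open>v\<close> uses exponents up to
    \<open>length v\<close>, possibly more than \<open>length (?d v)\<close>; hence the comparison
    with the full star of \<open>f\<close>.\<close>
  have "pow_lang F n v \<le> star_lang f (?d v)" for n
    using projects_to_upper[OF projects_to_pow_lang[OF assms]] pow_lang_le_star_lang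
    by (rule order.trans)
  then show "star_lang F v \<le> star_lang f (?d v)"
    unfolding star_lang_eq_Sup_fin[of F] by (intro Sup_fin.boundedI) auto
next
  let ?d = "filter (\<lambda>z. z \<notin> Y)"
  fix u p q t
  assume *: "\<And>v. ?d v = u \<Longrightarrow> p * star_lang F v * q \<le> t"
  have "p * pow_lang f n u * q \<le> t" for n
  proof (rule projects_to_least[OF projects_to_pow_lang[OF assms]])
    fix v assume "?d v = u"
    have "p * pow_lang F n v * q \<le> p * star_lang F v * q"
      by (intro mult_mono_lmonoid pow_lang_le_star_lang order.refl)
    then show "p * pow_lang F n v * q \<le> t" using *[OF \<open>?d v = u\<close>] by (rule order.trans)
  qed
  then show "p * star_lang f u * q \<le> t"
    unfolding star_lang_eq_Sup_fin by (intro mult_Sup_fin_mult_le) auto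
qed

section \<open>The induction on the expression\<close>

text \<open>Weighting commutes with the regular operations on central languages, and projection is
  stable under them. The hypotheses on \<open>letters r\<close> and \<open>scalars r\<close> pass to
  subexpressions.\<close>

lemma projects_to_lang:
  assumes "letters r \<inter> Y = {}"
    and "\<And>z. z \<notin> Y \<Longrightarrow> h z = 1"
    and "\<And>l. l \<in> scalars r \<Longrightarrow> b l \<in> Y \<and> h (b l) = l"
  shows "projects_to Y (weigh h (lang (regex_of b r))) (lang r)"
  using assms(1,3)
proof (induction r)
  case Empty
  then show ?case by (simp add: weigh_def projects_to_zero)
next
  case Eps
  then show ?case using projects_to_point[of Y "[]" 1] by (simp add: weigh_point cong: if_cong)
next
  case (Letter x)
  then show ?case using projects_to_point[of Y "[x]" 1] assms(2)
    by (simp add: weigh_point cong: if_cong)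
next
  case (Scale l r)
  have "central_lang (\<lambda>v. if v = [b l] then 1 else 0 :: 'b)"
    by (simp add: central_lang_def)
  \<comment> \<open>The letter \<open>b l\<close> has weight \<open>l\<close>. Its deletion leaves
    the value \<open>l\<close> at the empty word, and concatenation with that language is
    multiplication by \<open>l\<close>.\<close>
  then have "weigh h (lang (regex_of b (Scale l r)))
      = conc_lang (\<lambda>v. if v = [b l] then l else 0) (weigh h (lang (regex_of b r)))"
    using Scale.prems by (simp add: weigh_conc_lang weigh_point cong: if_cong)
  moreover have "projects_to Y (\<lambda>v. if v = [b l] then l else 0) (\<lambda>u. if u = [] then l else 0)"
    using projects_to_point[of Y "[b l]" l] Scale.prems by simp
  ultimately show ?case
    using projects_to_conc_lang Scale conc_lang_point_Nil[of l "lang r"] by force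
next
  case (Plus r s)
  have "weigh h (lang (regex_of b (Plus r s)))
      = (\<lambda>v. sup (weigh h (lang (regex_of b r)) v) (weigh h (lang (regex_of b s)) v))"
    by (simp add: weigh_def mult_sup_distrib_left fun_eq_iff)
  moreover have "projects_to Y (weigh h (lang (regex_of b r))) (lang r)"
    "projects_to Y (weigh h (lang (regex_of b s))) (lang s)"
    using Plus by (auto simp: Int_Un_distrib2)
  ultimately show ?case by (simp add: projects_to_sup)
next
  case (Times r s)
  have "projects_to Y (weigh h (lang (regex_of b r))) (lang r)"
    "projects_to Y (weigh h (lang (regex_of b s))) (lang s)"
    using Times by (auto simp: Int_Un_distrib2)
  then show ?case by (simp add: weigh_conc_lang central_lang_regex_of projects_to_conc_lang)
next
  case (Star r)
  then show ?case by (simp add: weigh_star_lang central_lang_regex_of projects_to_star_lang)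
qed

section \<open>The shuffle as a fibre of deletion, and the supremum formula\<close>

text \<open>Deletion maps a shuffle of \<open>u\<close> and \<open>w\<close> to a shuffle of
  \<open>u\<close> and the empty word, which is \<open>u\<close>. Conversely, any word is a shuffle
  of its kept and its deleted letters.\<close>

lemma U_set_eq_filter:
  assumes "set u \<inter> Y = {}"
  shows "U_set Y u = {v. filter (\<lambda>z. z \<notin> Y) v = u}"
  unfolding U_set_eq_shuffles
proof (intro equalityI subsetI)
  fix v assume "v \<in> (\<Union>w\<in>lists Y. shuffles u w)"
  then obtain w where w: "w \<in> lists Y" "v \<in> shuffles u w" by blast
  have "filter (\<lambda>z. z \<notin> Y) u = u" using assms by (auto simp: filter_id_conv)
  moreover have "filter (\<lambda>z. z \<notin> Y) w = []" using w(1) by (auto simp: filter_empty_conv)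
  moreover have "filter (\<lambda>z. z \<notin> Y) v \<in> filter (\<lambda>z. z \<notin> Y) ` shuffles u w" using w(2) by simp
  ultimately show "v \<in> {v. filter (\<lambda>z. z \<notin> Y) v = u}" by (simp add: filter_shuffles)
next
  fix v assume "v \<in> {v. filter (\<lambda>z. z \<notin> Y) v = u}"
  then have "v \<in> shuffles u (filter (\<lambda>z. z \<in> Y) v)"
    using partition_in_shuffles[of v "\<lambda>z. z \<notin> Y"] by simp
  moreover have "filter (\<lambda>z. z \<in> Y) v \<in> lists Y" by auto
  ultimately show "v \<in> (\<Union>w\<in>lists Y. shuffles u w)" by blast
qed

theorem theorem3p6:
  fixes X Y :: "'a set"
    and \<alpha> :: "('l::integral_lmonoid, 'a) fregex"
    and b :: "'l \<Rightarrow> 'a"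
    and u :: "'a list"
  assumes "finite X"
    and "letters \<alpha> \<subseteq> X"
    and "associated_alphabet X \<alpha> Y b"
    and "u \<in> lists X"
  shows "isLub UNIV ((\<lambda>v. phi \<alpha> Y b v * lang (regex_of b \<alpha>) v) ` U_set Y u) (lang \<alpha> u)"
proof -
  \<comment> \<open>The letter weight whose homomorphic extension is
    \<open>phi \<alpha> Y b\<close>.\<close>
  define h where "h = (\<lambda>z. if z \<in> Y then inv_into (scalars \<alpha>) b z else 1)"
  have XY: "Y \<inter> X = {}" and bij: "bij_betw b (scalars \<alpha>) Y"
    using assms(3) by (auto simp: associated_alphabet_def)
  have "set u \<inter> Y = {}" using assms(4) XY by auto
  note U = U_set_eq_filter[OF this]
  have weigh: "phi \<alpha> Y b v * lang (regex_of b \<alpha>) v = weigh h (lang (regex_of b \<alpha>)) v" for v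
    by (simp add: weigh_def phi_def h_def)
  have proj: "projects_to Y (weigh h (lang (regex_of b \<alpha>))) (lang \<alpha>)"
  proof (rule projects_to_lang)
    show "letters \<alpha> \<inter> Y = {}" using assms(2) XY by blast
    show "b l \<in> Y \<and> h (b l) = l" if "l \<in> scalars \<alpha>" for l
      using that bij bij_betwE[OF bij] by (simp add: h_def bij_betw_inv_into_left)
  qed (simp add: h_def)
  show ?thesis unfolding weigh U
  proof (rule isLubI2)
    let ?A = "weigh h (lang (regex_of b \<alpha>)) ` {v. filter (\<lambda>z. z \<notin> Y) v = u}"
    show "isUb UNIV ?A (lang \<alpha> u)"
      using projects_to_upper[OF proj] by (auto intro!: isUbI setleI)
    show "lang \<alpha> u <=* Collect (isUb UNIV ?A)"
    proof (rule setgeI, safe)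
      fix t assume "isUb UNIV ?A t"
      then show "lang \<alpha> u \<le> t"
        \<comment> \<open>The contexts served only the induction; here both are the unit.\<close>
        using projects_to_least[OF proj, of u 1 1 t] by (auto simp: isUb_def setle_def)
    qed
  qed
qed

end
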